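(* For any $n\ge1$ and any pattern pair $p\in\{(012,021),(110,012)\}$, we have $|\mathbf{I}_n(p)|=2^n-n$.
   Context: An inversion sequence of length $n$ is an integer sequence $e=(e_1,\dots,e_n)$ with $0\le e_i\le i-1$ for all $1\le i\le n$. A word $w_1\cdots w_n$ avoids a pattern $P=p_1\cdots p_k$ if there are no $i_1<\cdots<i_k$ such that $w_{i_1}\cdots w_{i_k}$ is order isomorphic to $P$ (equal letters of $P$ corresponding to equal entries). For a pair $p=(P_1,P_2)$ of patterns, $\mathbf{I}_n(p)$ denotes the set of inversion sequences of length $n$ avoiding both $P_1$ and $P_2$. *)

theory Defs
  imports Main "HOL-Library.Sublist"
begin

text \<open>Lists are indexed from 0, so the bound \<open>0 \<le> e\<^sub>i \<le> i - 1\<close> for \<open>1 \<le> i \<le> n\<close> becomes \<open>e ! i \<le> i\<close>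
  for \<open>i < n\<close>.\<close>

definition inversion_seqs :: "nat \<Rightarrow> nat list set" where
  "inversion_seqs n = {e. length e = n \<and> (\<forall>i<n. e ! i \<le> i)}"

definition order_isomorphic :: "nat list \<Rightarrow> nat list \<Rightarrow> bool" where
  "order_isomorphic u v \<longleftrightarrow> length u = length v \<and>
     (\<forall>i<length u. \<forall>j<length u.
        (u ! i < u ! j \<longleftrightarrow> v ! i < v ! j) \<and> (u ! i = u ! j \<longleftrightarrow> v ! i = v ! j))"

text \<open>The subwords \<open>w\<^bsub>i\<^sub>1\<^esub> \<dots> w\<^bsub>i\<^sub>k\<^esub>\<close> with \<open>i\<^sub>1 < \<dots> < i\<^sub>k\<close>, not necessarily contiguous, are the
  lists related to \<open>w\<close> by \<^const>\<open>subseq\<close>.\<close>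

definition avoids :: "nat list \<Rightarrow> nat list \<Rightarrow> bool" where
  "avoids w P \<longleftrightarrow> \<not> (\<exists>u. subseq u w \<and> order_isomorphic u P)"

definition inversion_seqs_avoiding :: "nat \<Rightarrow> nat list \<times> nat list \<Rightarrow> nat list set" where
  "inversion_seqs_avoiding n p = {e \<in> inversion_seqs n. avoids e (fst p) \<and> avoids e (snd p)}"

end

theory Submission imports Defs
begin

text \<open>
  An inversion sequence starts with \<open>0\<close>, and this \<open>0\<close> serves as the smallest letter of any pattern
  \<open>012\<close> or \<open>021\<close>. Hence avoidance only constrains how the positive entries follow each other:

  \<^item> avoiding \<open>012\<close> and \<open>021\<close> means that all positive entries are equal;
  \<^item> avoiding \<open>110\<close> and \<open>012\<close> means that the positive entries decrease strictly, zeros being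
    interspersed freely, until some positive value recurs; from that second occurrence on,
    the sequence is constant.

  In both cases everything after the first positive entry \<open>x\<close> is governed by \<open>x\<close> alone: the bound
  \<open>e ! i \<le> i\<close> holds automatically from there on, since later entries are at most \<open>x\<close>. So the
  sequences are counted by reading off leading zeros until the first positive entry appears
  (\<open>card_bounded_zeros_then_Suc\<close>), which reduces the problem to the number of continuations of
  length \<open>m\<close> after \<open>x\<close>. This number is \<open>2 ^ m\<close> for the first pair (each entry is \<open>0\<close> or \<open>x\<close>) and
  \<open>(m + x) choose x\<close> for the second (\<open>card_decreasing_then_constant\<close>). For the second pair, the
  sequences with first positive entry at index \<open>i\<close> then number \<open>(n choose i) - 1\<close> by the
  hockey-stick identity, and the sum over \<open>i < n\<close>, together with the zero sequence, is \<open>2 ^ n - n\<close>.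
\<close>

section \<open>Avoidance of patterns of length three\<close>

lemma subseq_imp_set_subset: "subseq u w \<Longrightarrow> set u \<subseteq> set w"
  by (auto dest: list_emb_set)

lemma subseq_pair_Cons:
  "subseq [y, z] (x # w) \<longleftrightarrow> (x = y \<and> z \<in> set w) \<or> subseq [y, z] w"
  by (auto simp: subseq_Cons2_iff subseq_singleton_left dest: subseq_Cons' intro: list_emb_set)

lemma subseq_triple_Cons:
  "subseq [y, z, v] (x # w) \<longleftrightarrow> (x = y \<and> subseq [z, v] w) \<or> subseq [y, z, v] w"
  by (auto simp: subseq_Cons2_iff dest: subseq_Cons')

\<comment> \<open>Its conditional right-hand side would pre-empt the two disjunctive rules above.\<close>
declare subseq_Cons2_iff [simp del]

lemma avoids_three_letters:
  "avoids w [a, b, c] \<longleftrightarrow>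
     (\<forall>x y z. subseq [x, y, z] w \<longrightarrow> \<not> order_isomorphic [x, y, z] [a, b, c])"
proof -
  have "\<exists>x y z. u = [x, y, z]" if "order_isomorphic u [a, b, c]" for u
    using that by (auto simp: order_isomorphic_def length_Suc_conv eval_nat_numeral)
  then show ?thesis
    unfolding avoids_def by metis
qed

lemma order_isomorphic_012: "order_isomorphic [x, y, z] [0, 1, 2] \<longleftrightarrow> x < y \<and> y < z"
  by (auto simp: order_isomorphic_def All_less_Suc eval_nat_numeral)

lemma order_isomorphic_021: "order_isomorphic [x, y, z] [0, 2, 1] \<longleftrightarrow> x < z \<and> z < y"
  by (auto simp: order_isomorphic_def All_less_Suc eval_nat_numeral)

lemma order_isomorphic_110: "order_isomorphic [x, y, z] [1, 1, 0] \<longleftrightarrow> x = y \<and> z < y"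
  by (auto simp: order_isomorphic_def All_less_Suc eval_nat_numeral)

text \<open>For the patterns starting with their unique smallest letter, the prepended \<open>0\<close> can replace
  the first letter of any occurrence, which leaves a condition on pairs of positive entries.\<close>

lemma avoids_012_zero_Cons:
  "avoids (0 # w) [0, 1, 2] \<longleftrightarrow> (\<forall>y z. subseq [y, z] w \<longrightarrow> 0 < y \<longrightarrow> z \<le> y)"
  unfolding avoids_three_letters order_isomorphic_012 subseq_triple_Cons
  by (meson gr0I leD le_less_trans not_le subseq_Cons' zero_le)

lemma avoids_021_zero_Cons:
  "avoids (0 # w) [0, 2, 1] \<longleftrightarrow> (\<forall>y z. subseq [y, z] w \<longrightarrow> 0 < z \<longrightarrow> y \<le> z)"
  unfolding avoids_three_letters order_isomorphic_021 subseq_triple_Cons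
  by (meson gr0I leD le_less_trans not_le subseq_Cons' zero_le)

text \<open>In \<open>110\<close> the first letter is not the smallest, so the prepended \<open>0\<close> takes part in no
  occurrence.\<close>

lemma avoids_110_zero_Cons:
  "avoids (0 # w) [1, 1, 0] \<longleftrightarrow> (\<forall>y z. subseq [y, y, z] w \<longrightarrow> y \<le> z)"
  unfolding avoids_three_letters order_isomorphic_110 subseq_triple_Cons
  by (auto simp: not_less)

section \<open>Leading zeros and the first positive entry\<close>

text \<open>\<open>T x w\<close> says that \<open>w\<close> is an admissible continuation after the first positive entry \<open>x\<close>.\<close>

fun zeros_then :: "(nat \<Rightarrow> nat list \<Rightarrow> bool) \<Rightarrow> nat list \<Rightarrow> bool" where
  "zeros_then T [] \<longleftrightarrow> True"
| "zeros_then T (x # w) \<longleftrightarrow> (if x = 0 then zeros_then T w else T x w)"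

text \<open>These are the final segments, starting at index \<open>i\<close>, of inversion sequences whose first
  \<open>i\<close> entries vanish.\<close>

definition bounded_zeros_then :: "(nat \<Rightarrow> nat list \<Rightarrow> bool) \<Rightarrow> nat \<Rightarrow> nat \<Rightarrow> nat list set" where
  "bounded_zeros_then T i m =
     {w. length w = m \<and> zeros_then T w \<and> (\<forall>j<m. w ! j \<le> i + j)}"

lemma card_words_by_first_letter:
  fixes P :: "nat list \<Rightarrow> bool"
  assumes bound: "\<And>w. P w \<Longrightarrow> length w = Suc m \<Longrightarrow> \<forall>x\<in>set w. x \<le> b"
  shows "card {w. length w = Suc m \<and> P w} = (\<Sum>x\<le>b. card {w. length w = m \<and> P (x # w)})"
proof -
  have fin: "finite {w. length w = m \<and> P (x # w)}" for x
  proof (rule finite_subset)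
    show "{w. length w = m \<and> P (x # w)} \<subseteq> {w. set w \<subseteq> {..b} \<and> length w = m}"
      using bound[of "x # _"] by fastforce
  qed (simp add: finite_lists_length_eq)
  have "{w. length w = Suc m \<and> P w} = (\<Union>x\<le>b. Cons x ` {w. length w = m \<and> P (x # w)})"
    using bound by (fastforce simp: length_Suc_conv)
  also have "card \<dots> = (\<Sum>x\<le>b. card (Cons x ` {w. length w = m \<and> P (x # w)}))"
    by (rule card_UN_disjoint) (use fin in auto)
  also have "\<dots> = (\<Sum>x\<le>b. card {w. length w = m \<and> P (x # w)})"
    by (simp add: card_image)
  finally show ?thesis .
qed

lemma card_bounded_zeros_then_0: "card (bounded_zeros_then T i 0) = 1"
proof -
  have "bounded_zeros_then T i 0 = {[]}"
    by (auto simp: bounded_zeros_then_def)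
  then show ?thesis by simp
qed

text \<open>A leading \<open>0\<close> shifts the start index by one; a leading positive entry \<open>x\<close> makes the index
  bounds redundant, because by assumption no later entry exceeds \<open>x\<close>.\<close>

lemma card_bounded_zeros_then_Suc:
  assumes T: "\<And>x w. T x w \<Longrightarrow> \<forall>y\<in>set w. y \<le> x"
  shows "card (bounded_zeros_then T i (Suc m)) =
    card (bounded_zeros_then T (Suc i) m) + (\<Sum>x=1..i. card {w. length w = m \<and> T x w})"
proof -
  let ?P = "\<lambda>w. zeros_then T w \<and> (\<forall>j<Suc m. w ! j \<le> i + j)"
  have "card {w. length w = Suc m \<and> ?P w} = (\<Sum>x\<le>i + m. card {w. length w = m \<and> ?P (x # w)})"
    by (rule card_words_by_first_letter) (force simp: in_set_conv_nth)
  also have "\<dots> = (\<Sum>x\<le>i. card {w. length w = m \<and> ?P (x # w)})"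
    by (rule sum.mono_neutral_right) (auto simp: card_eq_0_iff)
  also have "\<dots> = card {w. length w = m \<and> ?P (0 # w)}
      + (\<Sum>x=1..i. card {w. length w = m \<and> ?P (x # w)})"
    by (simp add: atMost_atLeast0 sum.atLeast_Suc_atMost)
  also have "{w. length w = m \<and> ?P (0 # w)} = bounded_zeros_then T (Suc i) m"
    by (auto simp: bounded_zeros_then_def All_less_Suc2)
  also have "(\<Sum>x=1..i. card {w. length w = m \<and> ?P (x # w)})
      = (\<Sum>x=1..i. card {w. length w = m \<and> T x w})"
  proof (intro sum.cong refl arg_cong[where f = card] Collect_cong conj_cong)
    fix x and w :: "nat list" assume x: "x \<in> {1..i}" and "length w = m"
    then have "w ! j \<le> Suc (i + j)" if "T x w" "j < m" for j
      using T[OF that(1)] that(2) nth_mem[of j w] by fastforce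
    then show "?P (x # w) \<longleftrightarrow> T x w"
      using x by (auto simp: All_less_Suc2)
  qed
  finally show ?thesis
    by (simp add: bounded_zeros_then_def)
qed

lemma inversion_seqs_avoiding_eq:
  assumes "n \<ge> 1"
    and char: "\<And>w. avoids (0 # w) (fst p) \<and> avoids (0 # w) (snd p) \<longleftrightarrow> zeros_then T w"
  shows "inversion_seqs_avoiding n p = bounded_zeros_then T 0 n"
proof -
  have "avoids e (fst p) \<and> avoids e (snd p) \<longleftrightarrow> zeros_then T e"
    if e: "length e = n" "\<forall>i<n. e ! i \<le> i" for e
  proof -
    obtain w where "e = 0 # w"
      using e \<open>n \<ge> 1\<close> by (cases e) auto
    then show ?thesis using char by simp
  qed
  then show ?thesis
    by (auto simp: inversion_seqs_avoiding_def inversion_seqs_def bounded_zeros_then_def)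
qed

section \<open>The pair 012, 021\<close>

definition zeros_or :: "nat \<Rightarrow> nat list \<Rightarrow> bool" where
  "zeros_or x w \<longleftrightarrow> set w \<subseteq> {0, x}"

lemma positive_pairs_equal_iff:
  "(\<forall>y z. subseq [y, z] w \<longrightarrow> 0 < y \<longrightarrow> 0 < z \<longrightarrow> y = z) \<longleftrightarrow> zeros_then zeros_or w"
proof (induction w)
  case (Cons x w)
  \<comment> \<open>Two entries of the tail, both in \<open>{0, x}\<close>, cannot be positive and different.\<close>
  have "y = z" if "set w \<subseteq> {0, x}" "subseq [y, z] w" "0 < y" "0 < z" for y z
    using that(1,3,4) subseq_imp_set_subset[OF that(2)] by auto
  then have "(\<forall>y z. subseq [y, z] (x # w) \<longrightarrow> 0 < y \<longrightarrow> 0 < z \<longrightarrow> y = z) \<longleftrightarrow> zeros_or x w"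
    if "x > 0"
    using that unfolding subseq_pair_Cons zeros_or_def by blast
  then show ?case
    using Cons.IH by (auto simp: subseq_pair_Cons)
qed simp

lemma avoids_012_021_iff:
  "avoids (0 # w) [0, 1, 2] \<and> avoids (0 # w) [0, 2, 1] \<longleftrightarrow> zeros_then zeros_or w"
  unfolding avoids_012_zero_Cons avoids_021_zero_Cons positive_pairs_equal_iff[symmetric]
  by (metis le_antisym le_eq_less_or_eq not_gr0 zero_le)

lemma card_zeros_or:
  assumes "x > 0"
  shows "card {w. length w = m \<and> zeros_or x w} = 2 ^ m"
  using card_lists_length_eq[of "{0, x}" m] assms
  by (simp add: zeros_or_def conj_commute numeral_2_eq_2)

text \<open>The closed form solves the recurrence \<open>N i (m + 1) = N (i + 1) m + i * 2 ^ m\<close>, where \<open>i\<close>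
  is the number of admissible values of a positive entry at index \<open>i\<close>.\<close>

lemma card_bounded_zeros_then_zeros_or:
  "card (bounded_zeros_then zeros_or i m) + i + m = (i + 1) * 2 ^ m"
proof (induction m arbitrary: i)
  case 0
  then show ?case by (simp add: card_bounded_zeros_then_0)
next
  case (Suc m)
  have "card (bounded_zeros_then zeros_or i (Suc m)) =
      card (bounded_zeros_then zeros_or (Suc i) m) + i * 2 ^ m"
    using card_bounded_zeros_then_Suc[of zeros_or i m]
    by (simp add: card_zeros_or) (auto simp: zeros_or_def)
  then show ?case
    using Suc.IH[of "Suc i"] by (simp add: algebra_simps)
qed

section \<open>The pair 110, 012\<close>

text \<open>Continuations after a positive entry \<open>a\<close> that has occurred once and is the smallest positive
  entry so far.\<close>

fun decreasing_then_constant :: "nat \<Rightarrow> nat list \<Rightarrow> bool" where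
  "decreasing_then_constant a [] \<longleftrightarrow> True"
| "decreasing_then_constant a (x # w) \<longleftrightarrow>
     (if x = a then set w \<subseteq> {a}
      else x < a \<and> decreasing_then_constant (if x = 0 then a else x) w)"

lemma decreasing_then_constant_le:
  "decreasing_then_constant a w \<Longrightarrow> \<forall>y\<in>set w. y \<le> a"
  by (induction a w rule: decreasing_then_constant.induct) (force split: if_splits)+

text \<open>The conditions on the right-hand side are those for \<open>a # w\<close>, sorted by whether the entry \<open>a\<close>
  takes part: the first is avoidance of \<open>012\<close> with \<open>a\<close> as the letter \<open>1\<close>, the last is avoidance
  of \<open>110\<close> with \<open>a\<close> as the first letter. Once a smaller positive entry \<open>x\<close> follows, \<open>a\<close> cannot
  recur, and the two conditions for \<open>x\<close> imply those for \<open>a\<close>; this is why the recursion needs to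
  remember one entry only.\<close>

lemma decreasing_then_constant_iff:
  assumes "a > 0"
  shows "decreasing_then_constant a w \<longleftrightarrow>
    (\<forall>y\<in>set w. y \<le> a) \<and>
    (\<forall>y z. subseq [y, z] w \<longrightarrow> 0 < y \<longrightarrow> z \<le> y) \<and>
    (\<forall>y z. subseq [y, y, z] w \<longrightarrow> y \<le> z) \<and>
    (\<forall>z. subseq [a, z] w \<longrightarrow> a \<le> z)"
    (is "_ \<longleftrightarrow> ?rhs a w")
  using assms
proof (induction w arbitrary: a)
  case (Cons x w)
  consider "x = a" | "a < x" | "x = 0" "x < a" | "0 < x" "x < a"
    by linarith
  then show ?case
  proof cases
    case 1
    have "set w \<subseteq> {a} \<longleftrightarrow> ?rhs a (x # w)"
    proof
      assume "set w \<subseteq> {a}"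
      then have "\<forall>y\<in>set (x # w). y \<le> a"
        using 1 by auto
      moreover have "y = a \<and> z = a"
        if "subseq [y, z] (x # w) \<or> subseq [y, y, z] (x # w)" for y z
        using that \<open>set w \<subseteq> {a}\<close> 1 by (auto dest!: subseq_imp_set_subset)
      ultimately show "?rhs a (x # w)"
        by blast
    next
      assume "?rhs a (x # w)"
      then have "a \<le> z \<and> z \<le> a" if "z \<in> set w" for z
        using that 1 by (simp add: subseq_pair_Cons)
      then show "set w \<subseteq> {a}"
        by force
    qed
    then show ?thesis
      using 1 by (simp only: decreasing_then_constant.simps if_True refl)
  next
    case 2
    then show ?thesis by auto
  next
    case 3
    then show ?thesis
      using Cons.IH[OF \<open>a > 0\<close>] by (auto simp: subseq_pair_Cons subseq_triple_Cons)
  next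
    case 4
    have "a \<notin> set w" if "\<forall>y\<in>set w. y \<le> x"
      using that 4 by auto
    then have no_a: "\<not> subseq [a, z] w" if "\<forall>y\<in>set w. y \<le> x" for z
      using that by (auto dest!: subseq_imp_set_subset)
    have "decreasing_then_constant a (x # w) \<longleftrightarrow> ?rhs x w"
      using 4 Cons.IH[OF \<open>0 < x\<close>] by simp
    also have "\<dots> \<longleftrightarrow> ?rhs a (x # w)"
    proof (cases "\<forall>y\<in>set w. y \<le> x")
      case True
      then have "\<forall>y\<in>set w. y \<le> a"
        using 4 by auto
      with True no_a[OF True] show ?thesis
        unfolding subseq_pair_Cons subseq_triple_Cons using 4 by auto
    next
      case False
      then have "\<not> ?rhs a (x # w)"
        using 4 by (auto simp: subseq_pair_Cons)
      moreover have "\<not> ?rhs x w"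
        using False by blast
      ultimately show ?thesis by (simp only:)
    qed
    finally show ?thesis .
  qed
qed simp

lemma avoids_110_012_iff:
  "avoids (0 # w) [1, 1, 0] \<and> avoids (0 # w) [0, 1, 2] \<longleftrightarrow>
     zeros_then decreasing_then_constant w"
  unfolding avoids_012_zero_Cons avoids_110_zero_Cons
proof (induction w)
  case (Cons x w)
  show ?case
  proof (cases "x = 0")
    case True
    then show ?thesis
      unfolding subseq_pair_Cons subseq_triple_Cons using Cons.IH by simp
  next
    case False
    then have "0 < x" by simp
    have "zeros_then decreasing_then_constant (x # w) \<longleftrightarrow> decreasing_then_constant x w"
      using False by simp
    also have "\<dots> \<longleftrightarrow> (\<forall>y z. subseq [y, y, z] (x # w) \<longrightarrow> y \<le> z) \<and>
        (\<forall>y z. subseq [y, z] (x # w) \<longrightarrow> 0 < y \<longrightarrow> z \<le> y)"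
      unfolding subseq_pair_Cons subseq_triple_Cons
        decreasing_then_constant_iff[OF \<open>0 < x\<close>]
      using \<open>0 < x\<close> by blast
    finally show ?thesis by (rule sym)
  qed
qed simp

text \<open>Splitting by the first letter turns the count into the recurrence that the hockey-stick
  identity gives for \<open>(m + a) choose a\<close>: the letter \<open>a\<close> allows one continuation only, the
  letter \<open>0\<close> keeps \<open>a\<close>, and a letter \<open>0 < x < a\<close> replaces \<open>a\<close> by \<open>x\<close>.\<close>

lemma card_decreasing_then_constant:
  assumes "a > 0"
  shows "card {w. length w = m \<and> decreasing_then_constant a w} = (m + a) choose a"
  using assms
proof (induction m arbitrary: a)
  case 0
  have "{w. length w = 0 \<and> decreasing_then_constant a w} = {[]}"
    by auto
  then show ?case by simp
next
  case (Suc m)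
  let ?c = "\<lambda>x. card {w. length w = m \<and> decreasing_then_constant a (x # w)}"
  have last: "?c a = 1"
  proof -
    have "{w. length w = m \<and> set w \<subseteq> {a}} = {replicate m a}"
      by (auto intro: replicate_eqI)
    then show ?thesis by simp
  qed
  have mid: "?c x = (m + x) choose x" if "x \<in> {1..<a}" for x
    using that Suc.IH[of x] by simp
  have zero: "?c 0 = (m + a) choose a"
    using Suc.prems Suc.IH[of a] by simp
  have hockey: "(\<Sum>x<a. (m + x) choose x) = (m + a) choose (a - 1)"
    using Suc.prems sum_choose_lower[of m "a - 1"] by (simp flip: lessThan_Suc_atMost)
  have "card {w. length w = Suc m \<and> decreasing_then_constant a w} = (\<Sum>x\<le>a. ?c x)"
    by (rule card_words_by_first_letter) (rule decreasing_then_constant_le)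
  also have "\<dots> = ?c 0 + (\<Sum>x=1..<a. ?c x) + ?c a"
    using Suc.prems
    by (simp add: lessThan_Suc_atMost[symmetric] lessThan_atLeast0 sum.atLeast_Suc_lessThan
        del: decreasing_then_constant.simps)
  also have "\<dots> = ((m + a) choose a) + (\<Sum>x<a. (m + x) choose x)"
    using Suc.prems
    by (simp add: last zero mid lessThan_atLeast0 sum.atLeast_Suc_lessThan
        del: decreasing_then_constant.simps)
  also have "\<dots> = (Suc m + a) choose a"
    using Suc.prems by (simp add: hockey choose_reduce_nat)
  finally show ?case .
qed

text \<open>Adding \<open>m\<close> compensates the \<open>- 1\<close> contributed by each of the \<open>m\<close> possible indices of the first
  positive entry; the summand \<open>k = i + m\<close> is the zero sequence. For \<open>i = 0\<close> the sum is a full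
  row of Pascal's triangle.\<close>

lemma card_bounded_zeros_then_decreasing:
  "card (bounded_zeros_then decreasing_then_constant i m) + m = (\<Sum>k=i..i + m. (i + m) choose k)"
proof (induction m arbitrary: i)
  case 0
  then show ?case by (simp add: card_bounded_zeros_then_0)
next
  case (Suc m)
  have "(\<Sum>x=1..i. card {w. length w = m \<and> decreasing_then_constant x w}) + 1
      = (\<Sum>x\<le>i. (m + x) choose x)"
    by (simp add: card_decreasing_then_constant atMost_atLeast0 sum.atLeast_Suc_atMost)
  also have "\<dots> = (i + Suc m) choose i"
    using sum_choose_lower[of m i] by (simp add: add.commute)
  finally have "card (bounded_zeros_then decreasing_then_constant i (Suc m)) + 1 =
      card (bounded_zeros_then decreasing_then_constant (Suc i) m) + ((i + Suc m) choose i)"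
    using card_bounded_zeros_then_Suc[of decreasing_then_constant i m,
        OF decreasing_then_constant_le] by simp
  then show ?case
    using Suc.IH[of "Suc i"] by (simp add: sum.atLeast_Suc_atMost)
qed

theorem theorem2p14:
  fixes n :: nat and p :: "nat list \<times> nat list"
  assumes "n \<ge> 1"
    and "p \<in> {([0, 1, 2], [0, 2, 1]), ([1, 1, 0], [0, 1, 2])}"
  shows "card (inversion_seqs_avoiding n p) = 2 ^ n - n"
proof -
  consider "p = ([0, 1, 2], [0, 2, 1])" | "p = ([1, 1, 0], [0, 1, 2])"
    using assms(2) by blast
  then show ?thesis
  proof cases
    case 1
    then have "inversion_seqs_avoiding n p = bounded_zeros_then zeros_or 0 n"
      using assms(1) avoids_012_021_iff by (intro inversion_seqs_avoiding_eq) simp_all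
    then show ?thesis
      using card_bounded_zeros_then_zeros_or[of 0 n] by simp
  next
    case 2
    then have "inversion_seqs_avoiding n p = bounded_zeros_then decreasing_then_constant 0 n"
      using assms(1) avoids_110_012_iff by (intro inversion_seqs_avoiding_eq) simp_all
    then show ?thesis
      using card_bounded_zeros_then_decreasing[of 0 n] choose_row_sum[of n]
      by (simp add: atMost_atLeast0)
  qed
qed

end
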